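(* Let $G:(\mathbb{R}^m,0)\to(\mathbb{R}^p,0)$, $m\ge p>0$, be a real analytic map germ. If $\operatorname{Sing}G\cap G^{-1}(0)=\{0\}$ (as set germs at $0$), then $G$ is a nice map germ (NMG).
   Context: Two subsets $A,A'$ of $\mathbb{R}^p$ have the same germ at $0$, written $(A,0)=(A',0)$, if $A\cap B=A'\cap B$ for some open ball $B$ centred at $0$. $B_\varepsilon$ is the open ball of radius $\varepsilon$ centred at $0\in\mathbb{R}^m$. For a set germ $K$ at $0\in\mathbb{R}^m$, $G(K)$ is a well-defined set germ at $0$ if $(G(B_\varepsilon\cap K),0)=(G(B_{\varepsilon'}\cap K),0)$ for all small enough $\varepsilon,\varepsilon'>0$; $\operatorname{Im}G$ corresponds to $K=\mathbb{R}^m$. $\operatorname{Sing}G$ is the set of points where $G$ is not a submersion (rank of the differential $<p$). $G$ is a nice map germ (NMG) if both $\operatorname{Im}G$ and $G(\operatorname{Sing}G)$ are well-defined set germs at $0$. *)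

theory Defs
  imports "HOL-Analysis.Analysis"
begin

(* A map germ at 0 is represented by a total function G; its values away from some
   neighbourhood of 0 are arbitrary. A set germ at 0 is represented by a set. Every notion
   below except Sing depends only on the germs at 0 involved, and the germ of Sing G at 0
   depends only on the germ of G. *)

(* Multi-indices are functions 'm => nat on the finite coordinate index type 'm, and has_sum
   is unconditional (hence absolute) convergence over all of them. *)
definition real_analytic_at :: "(real^'m \<Rightarrow> real^'p) \<Rightarrow> real^'m \<Rightarrow> bool" where
  "real_analytic_at f a \<longleftrightarrow>
     (\<exists>r>0. \<exists>c :: ('m \<Rightarrow> nat) \<Rightarrow> real^'p. \<forall>x\<in>ball a r.
        ((\<lambda>\<alpha>. (\<Prod>i\<in>UNIV. (x $ i - a $ i) ^ \<alpha> i) *\<^sub>R c \<alpha>) has_sum f x) UNIV)"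

definition real_analytic_map_germ :: "(real^'m \<Rightarrow> real^'p) \<Rightarrow> bool" where
  "real_analytic_map_germ G \<longleftrightarrow>
     (\<exists>U. open U \<and> 0 \<in> U \<and> (\<forall>a\<in>U. real_analytic_at G a)) \<and> G 0 = 0"

definition same_germ :: "'a::real_normed_vector set \<Rightarrow> 'a set \<Rightarrow> bool" where
  "same_germ A A' \<longleftrightarrow> (\<exists>r>0. A \<inter> ball 0 r = A' \<inter> ball 0 r)"

definition well_defined_image_germ ::
  "('a::real_normed_vector \<Rightarrow> 'b::real_normed_vector) \<Rightarrow> 'a set \<Rightarrow> bool" where
  "well_defined_image_germ G K \<longleftrightarrow>
     (\<exists>\<epsilon>0>0. \<forall>\<epsilon> \<epsilon>'. 0 < \<epsilon> \<and> \<epsilon> < \<epsilon>0 \<and> 0 < \<epsilon>' \<and> \<epsilon>' < \<epsilon>0 \<longrightarrow>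
        same_germ (G ` (ball 0 \<epsilon> \<inter> K)) (G ` (ball 0 \<epsilon>' \<inter> K)))"

(* Meaningful only where G is differentiable, which for a real analytic map germ is the case
   on a neighbourhood of 0. *)
definition Sing :: "(real^'m \<Rightarrow> real^'p) \<Rightarrow> (real^'m) set" where
  "Sing G = {x. rank (jacobian G (at x)) < CARD('p)}"

definition nice_map_germ :: "(real^'m \<Rightarrow> real^'p) \<Rightarrow> bool" where
  "nice_map_germ G \<longleftrightarrow>
     well_defined_image_germ G UNIV \<and> well_defined_image_germ G (Sing G)"

end

theory Submission
  imports Defs
begin

text \<open>
  If \<open>K \<inter> G\<inverse>(0) = {0}\<close> near 0 with \<open>K\<close> closed, then by compactness \<open>G\<close> is bounded away from 0 on
  the part of \<open>K\<close> in an annulus around 0, so the germ at 0 of the image of \<open>K \<inter> B\<^sub>\<epsilon>\<close> does not depend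
  on \<open>\<epsilon>\<close>. This settles \<open>K = Sing G\<close>, and also the full image when 0 is isolated in its fibre.
  Otherwise the fibre contains points \<open>x \<noteq> 0\<close> arbitrarily close to 0; \<open>G\<close> is a submersion there, so
  the image of every ball is a neighbourhood of 0.

  That \<open>Sing G\<close> is closed near 0 needs continuity of the differential. Instead of differentiating the
  power series at nearby points, one reads off strict differentiability at its centre, which
  makes surjectivity of the differential an open condition.
\<close>

section \<open>Absolute summability and strict differentiability\<close>

text \<open>Each real coordinate is unconditionally, hence absolutely, summable, and the norm is at
  most the sum of the finitely many coordinate moduli. This supplies the convergent majorant for the
  power series.\<close>

lemma abs_summable_on_vec:
  fixes f :: "'a \<Rightarrow> real^'n"
  assumes "f summable_on A"
  shows "(\<lambda>x. norm (f x)) summable_on A"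
proof -
  have "(\<lambda>x. \<bar>f x $ j\<bar>) summable_on A" for j
  proof -
    have "((\<lambda>x. f x $ j) \<circ> id) summable_on A"
      using has_sum_bounded_linear[OF bounded_linear_vec_nth] assms
      by (force simp: summable_on_def o_def)
    then show ?thesis
      using summable_on_iff_abs_summable_on_real[of "\<lambda>x. f x $ j" A] by (simp add: o_def)
  qed
  then have "(\<lambda>x. \<Sum>j\<in>UNIV. \<bar>f x $ j\<bar>) summable_on A"
    by (induction rule: finite_induct[OF finite[of "UNIV :: 'n set"]]) (auto intro: summable_on_add)
  then show ?thesis
    by (rule Infinite_Sum.abs_summable_on_comparison_test') (rule norm_le_l1_cart)
qed

text \<open>Both \<open>y\<close> and \<open>z\<close> vary, whereas the ordinary derivative fixes
  \<open>z = a\<close>. An estimate at \<open>a\<close> therefore also constrains the derivatives at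
  points near \<open>a\<close>.\<close>

definition strictly_differentiable_at ::
  "('a::real_normed_vector \<Rightarrow> 'b::real_normed_vector) \<Rightarrow> ('a \<Rightarrow> 'b) \<Rightarrow> 'a \<Rightarrow> bool" where
  "strictly_differentiable_at f L a \<longleftrightarrow> bounded_linear L \<and>
     (\<forall>e>0. \<exists>d>0. \<forall>y\<in>ball a d. \<forall>z\<in>ball a d. norm (f y - f z - L (y - z)) \<le> e * norm (y - z))"

lemma strictly_differentiable_at_imp_has_derivative:
  assumes "strictly_differentiable_at f L a"
  shows "(f has_derivative L) (at a)"
proof -
  have "\<exists>d>0. \<forall>y. norm (y - a) < d \<longrightarrow> norm (f y - f a - L (y - a)) \<le> e * norm (y - a)"
    if "e > 0" for e
  proof -
    obtain d where "d > 0" and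
      d: "\<And>y z. \<lbrakk>y \<in> ball a d; z \<in> ball a d\<rbrakk> \<Longrightarrow> norm (f y - f z - L (y - z)) \<le> e * norm (y - z)"
      using assms \<open>e > 0\<close> unfolding strictly_differentiable_at_def by meson
    then show ?thesis
      by (intro exI[of _ d]) (auto simp: dist_norm norm_minus_commute)
  qed
  then show ?thesis
    using assms unfolding has_derivative_at_alt strictly_differentiable_at_def by blast
qed

text \<open>Compare \<open>f\<close> at \<open>x\<close> and \<open>x + t h\<close>: the increment
  is \<open>L (t h)\<close> up to \<open>e * norm (t h)\<close>, and \<open>D (t h)\<close> up to an
  arbitrarily small multiple of \<open>norm (t h)\<close>. Dividing by \<open>t\<close> gives the
  bound. Used with strict differentiability, it makes \<open>D\<close> close to \<open>L\<close>
  without any continuity of the derivative.\<close>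

lemma strictly_differentiable_at_derivative_bound:
  assumes est: "\<And>y z. \<lbrakk>y \<in> S; z \<in> S\<rbrakk> \<Longrightarrow> norm (f y - f z - L (y - z)) \<le> e * norm (y - z)"
    and "open S" "x \<in> S" "bounded_linear L" and der: "(f has_derivative D) (at x)"
  shows "norm (D h - L h) \<le> e * norm h"
proof (rule field_le_epsilon)
  fix \<eta> :: real
  assume "\<eta> > 0"
  interpret L: bounded_linear L by fact
  interpret D: bounded_linear D using der by (rule has_derivative_bounded_linear)
  \<comment> \<open>Chosen so that \<open>e' * norm h\<close> is at most \<open>\<eta>\<close>; the
    added 1 covers \<open>h = 0\<close>.\<close>
  define e' where "e' = \<eta> / (norm h + 1)"
  have "e' > 0" using \<open>\<eta> > 0\<close> unfolding e'_def
    by (intro divide_pos_pos) (auto intro: add_nonneg_pos)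
  obtain d1 where d1: "d1 > 0" "ball x d1 \<subseteq> S"
    using assms(2,3) open_contains_ball by blast
  obtain d2 where d2: "d2 > 0"
    "\<And>y. norm (y - x) < d2 \<Longrightarrow> norm (f y - f x - D (y - x)) \<le> e' * norm (y - x)"
    using der \<open>e' > 0\<close> unfolding has_derivative_at_alt by meson
  \<comment> \<open>Small enough that \<open>x + t h\<close> stays both in \<open>S\<close> and
    within reach of the derivative estimate at \<open>x\<close>.\<close>
  define t where "t = min d1 d2 / (2 * (norm h + 1))"
  have "t > 0" using d1 d2 unfolding t_def
    by (intro divide_pos_pos) (auto intro: add_nonneg_pos)
  have "t * norm h \<le> t * (norm h + 1)" using \<open>t > 0\<close> by simp
  also have "\<dots> = min d1 d2 / 2"
    using norm_ge_zero[of h] unfolding t_def by (simp add: field_simps add_nonneg_eq_0_iff)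
  also have "\<dots> < min d1 d2" using d1 d2 by linarith
  finally have th: "t * norm h < min d1 d2" .
  define y where "y = x + t *\<^sub>R h"
  have ny: "norm (y - x) = t * norm h" using \<open>t > 0\<close> by (simp add: y_def)
  then have "y \<in> S" using th d1 by (auto simp: dist_norm norm_minus_commute)
  have "norm (D (y - x) - L (y - x))
      \<le> norm (f y - f x - L (y - x)) + norm (f y - f x - D (y - x))"
    using norm_triangle_ineq4[of "f y - f x - L (y - x)" "f y - f x - D (y - x)"] by simp
  also have "\<dots> \<le> e * norm (y - x) + e' * norm (y - x)"
    using est[OF \<open>y \<in> S\<close> \<open>x \<in> S\<close>] d2(2)[of y] ny th by simp
  finally have "norm (t *\<^sub>R (D h - L h)) \<le> t * ((e + e') * norm h)"
    unfolding ny by (simp add: y_def D.scaleR L.scaleR scaleR_diff_right algebra_simps)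
  then have "norm (D h - L h) \<le> e * norm h + e' * norm h"
    using \<open>t > 0\<close> by (simp add: distrib_right)
  also have "e' * norm h \<le> \<eta>"
    using \<open>\<eta> > 0\<close> add_nonneg_pos[OF norm_ge_zero[of h] zero_less_one]
    unfolding e'_def by (simp add: divide_simps)
  finally show "norm (D h - L h) \<le> e * norm h + \<eta>" by simp
qed

section \<open>Estimates for monomials\<close>

text \<open>Replace the factors one at a time: all of them have modulus at most 1, so the errors of
  the single powers add up, and each is at most the exponent times \<open>\<delta>\<close>.\<close>

lemma prod_power_diff_le:
  fixes u v :: "'i \<Rightarrow> real" and \<alpha> :: "'i \<Rightarrow> nat"
  assumes "\<And>i. i \<in> I \<Longrightarrow> \<bar>u i\<bar> \<le> 1" "\<And>i. i \<in> I \<Longrightarrow> \<bar>v i\<bar> \<le> 1"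
    and "\<And>i. i \<in> I \<Longrightarrow> \<bar>u i - v i\<bar> \<le> \<delta>"
  shows "\<bar>(\<Prod>i\<in>I. u i ^ \<alpha> i) - (\<Prod>i\<in>I. v i ^ \<alpha> i)\<bar> \<le> real (sum \<alpha> I) * \<delta>"
proof -
  have "\<bar>(\<Prod>i\<in>I. u i ^ \<alpha> i) - (\<Prod>i\<in>I. v i ^ \<alpha> i)\<bar> \<le> (\<Sum>i\<in>I. \<bar>u i ^ \<alpha> i - v i ^ \<alpha> i\<bar>)"
    using norm_prod_diff[of I "\<lambda>i. u i ^ \<alpha> i" "\<lambda>i. v i ^ \<alpha> i"] assms
    by (simp add: power_abs power_le_one)
  also have "\<dots> \<le> (\<Sum>i\<in>I. real (\<alpha> i) * \<delta>)"
  proof (rule sum_mono)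
    fix i assume i: "i \<in> I"
    have "\<bar>u i ^ \<alpha> i - v i ^ \<alpha> i\<bar> \<le> real (\<alpha> i) * \<bar>u i - v i\<bar>"
      using norm_power_diff[of "u i" "v i" "\<alpha> i"] assms i by simp
    also have "\<dots> \<le> real (\<alpha> i) * \<delta>"
      using assms i by (intro mult_left_mono) auto
    finally show "\<bar>u i ^ \<alpha> i - v i ^ \<alpha> i\<bar> \<le> real (\<alpha> i) * \<delta>" .
  qed
  finally show ?thesis by (simp add: sum_distrib_right)
qed

text \<open>Dividing all coordinates by \<open>\<rho>\<close> reduces to the unit case and pulls out
  \<open>\<rho>\<close> to the total degree. This power later absorbs the degree factor.\<close>

lemma prod_power_diff_le_scaled:
  fixes u v :: "'i \<Rightarrow> real" and \<alpha> :: "'i \<Rightarrow> nat"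
  assumes "\<rho> > 0" "\<And>i. i \<in> I \<Longrightarrow> \<bar>u i\<bar> \<le> \<rho>" "\<And>i. i \<in> I \<Longrightarrow> \<bar>v i\<bar> \<le> \<rho>"
    and "\<And>i. i \<in> I \<Longrightarrow> \<bar>u i - v i\<bar> \<le> \<delta>"
  shows "\<bar>(\<Prod>i\<in>I. u i ^ \<alpha> i) - (\<Prod>i\<in>I. v i ^ \<alpha> i)\<bar>
           \<le> \<rho> ^ sum \<alpha> I * (real (sum \<alpha> I) * (\<delta> / \<rho>))"
proof -
  have scale: "(\<Prod>i\<in>I. w i ^ \<alpha> i) = \<rho> ^ sum \<alpha> I * (\<Prod>i\<in>I. (w i / \<rho>) ^ \<alpha> i)" for w
    using \<open>\<rho> > 0\<close> by (simp add: power_sum power_divide flip: prod.distrib)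
  have "\<bar>(\<Prod>i\<in>I. (u i / \<rho>) ^ \<alpha> i) - (\<Prod>i\<in>I. (v i / \<rho>) ^ \<alpha> i)\<bar> \<le> real (sum \<alpha> I) * (\<delta> / \<rho>)"
    using assms by (intro prod_power_diff_le) (auto simp: divide_right_mono simp flip: diff_divide_distrib)
  from mult_left_mono[OF this, of "\<rho> ^ sum \<alpha> I"] show ?thesis
    unfolding scale[of u] scale[of v] right_diff_distrib[symmetric] abs_mult
    using \<open>\<rho> > 0\<close> by simp
qed

lemma times_power_le_of_le_half:
  fixes t :: real
  assumes "0 < t" "t \<le> 1/2" "2 \<le> n"
  shows "real n * t ^ n \<le> 2 * t\<^sup>2"
proof -
  have bound: "real (k + 2) * t ^ k \<le> 2" for k
  proof (induction k)
    case (Suc k)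
    \<comment> \<open>The coefficient at most doubles while the power at least halves.\<close>
    have "real (Suc k + 2) * t ^ Suc k \<le> real (2 * (k + 2)) * (1/2 * t ^ k)"
      using assms by (intro mult_mono) (auto simp: mult_right_mono)
    also have "\<dots> = real (k + 2) * t ^ k" by simp
    finally show ?case using Suc by linarith
  qed simp
  obtain k where k: "n = k + 2"
    using assms(3) by (metis le_add_diff_inverse2)
  have "real (k + 2) * t ^ k * t\<^sup>2 \<le> 2 * t\<^sup>2"
    by (intro mult_right_mono bound) simp
  then show ?thesis
    unfolding k power_add by (simp only: mult.assoc)
qed

section \<open>Power series at their centre\<close>

lemma sum_eq_1_indicator:
  fixes \<alpha> :: "'i::finite \<Rightarrow> nat"
  assumes "sum \<alpha> UNIV = 1"
  shows "\<exists>i. \<alpha> = (\<lambda>j. of_bool (j = i))"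
proof -
  obtain i where i: "\<alpha> i = 1" "\<And>j. j \<noteq> i \<Longrightarrow> \<alpha> j = 0"
    using assms sum_eq_1_iff[of UNIV \<alpha>] by (metis UNIV_I finite)
  then show ?thesis by (intro exI[of _ i]) auto
qed

lemma has_sum_diff:
  fixes f g :: "'a \<Rightarrow> 'b::real_normed_vector"
  assumes "(f has_sum a) A" "(g has_sum b) A"
  shows "((\<lambda>x. f x - g x) has_sum (a - b)) A"
  using has_sum_add[OF assms(1) has_sum_scaleR[OF assms(2), of "-1"]] by simp

text \<open>In \<open>f y - f z\<close> the constant terms cancel and the terms of degree 1 sum to
  \<open>L (y - z)\<close>. On a ball of radius at most \<open>t * s\<close> the terms of degree at
  least 2 are bounded by \<open>norm (y - z)\<close> times a constant of order \<open>t\<close>,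
  which is made small by shrinking \<open>t\<close>.\<close>

lemma real_analytic_at_imp_strictly_differentiable_at:
  fixes f :: "real^'m \<Rightarrow> real^'p"
  assumes "real_analytic_at f a"
  shows "\<exists>L. strictly_differentiable_at f L a"
proof -
  obtain r c where "r > 0" and f: "\<And>x. x \<in> ball a r \<Longrightarrow>
     ((\<lambda>\<alpha>. (\<Prod>i\<in>UNIV. (x $ i - a $ i) ^ \<alpha> i) *\<^sub>R c \<alpha>) has_sum f x) UNIV"
    using assms unfolding real_analytic_at_def by blast
  define e :: "'m \<Rightarrow> 'm \<Rightarrow> nat" where "e i = (\<lambda>j. of_bool (j = i))" for i
  define L where "L h = (\<Sum>i\<in>UNIV. h $ i *\<^sub>R c (e i))" for h
  have bl: "bounded_linear L"
    unfolding L_def by (intro bounded_linear_sum bounded_linear_scaleR_const bounded_linear_vec_nth)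
  have inj: "inj e"
  proof (rule injI)
    fix i i' assume "e i = e i'"
    then have "e i i = e i' i" by simp
    then show "i = i'" by (simp add: e_def of_bool_def split: if_splits)
  qed
  have prod_e: "(\<Prod>j\<in>UNIV. w j ^ e i j) = w i" for w :: "'m \<Rightarrow> real" and i
  proof -
    have "(\<Prod>j\<in>UNIV. w j ^ e i j) = (\<Prod>j\<in>UNIV. if j = i then w j else 1)"
      by (intro prod.cong) (auto simp: e_def)
    then show ?thesis by simp
  qed
  have sum_e: "sum (e i) UNIV = 1" for i
    by (simp add: e_def of_bool_def)
  \<comment> \<open>\<open>L\<close> is written as a series over all multi-indices so that it can be
    subtracted term by term.\<close>
  have linear_part: "((\<lambda>\<alpha>. if sum \<alpha> UNIV = 1 then (\<Prod>i\<in>UNIV. (h $ i) ^ \<alpha> i) *\<^sub>R c \<alpha> else 0)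
      has_sum L h) UNIV" for h :: "real^'m"
  proof (rule has_sum_finite_neutralI[of "range e"])
    show "L h = (\<Sum>\<alpha>\<in>range e. if sum \<alpha> UNIV = 1 then (\<Prod>i\<in>UNIV. (h $ i) ^ \<alpha> i) *\<^sub>R c \<alpha> else 0)"
      by (simp only: sum.reindex[OF inj] o_def prod_e sum_e if_True L_def refl)
    show "(if sum \<alpha> UNIV = 1 then (\<Prod>i\<in>UNIV. (h $ i) ^ \<alpha> i) *\<^sub>R c \<alpha> else 0) = 0"
      if "\<alpha> \<in> UNIV - range e" for \<alpha>
      using that sum_eq_1_indicator[of \<alpha>] unfolding e_def by force
  qed auto
  \<comment> \<open>The point with all offsets from \<open>a\<close> equal to \<open>s\<close> has
    l1 distance \<open>r / 2\<close> from \<open>a\<close>, so the series converges there. On this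
    diagonal every monomial is a power of \<open>s\<close>, and absolute convergence yields the
    majorant with sum \<open>M\<close>.\<close>
  define s where "s = r / (2 * real CARD('m))"
  have "s > 0" using \<open>r > 0\<close> by (simp add: s_def)
  have "norm ((\<chi> i. s) :: real^'m) \<le> (\<Sum>i\<in>(UNIV::'m set). \<bar>s\<bar>)"
    using norm_le_l1_cart[of "(\<chi> i. s) :: real^'m"] by simp
  also have "\<dots> < r" using \<open>r > 0\<close> by (simp add: s_def)
  finally have "a + (\<chi> i. s) \<in> ball a r" by (simp add: dist_norm)
  from f[OF this] have "((\<lambda>\<alpha>. s ^ sum \<alpha> UNIV *\<^sub>R c \<alpha>) has_sum f (a + (\<chi> i. s))) UNIV"
    by (simp add: power_sum)
  then have "(\<lambda>\<alpha>. norm (s ^ sum \<alpha> UNIV *\<^sub>R c \<alpha>)) summable_on UNIV"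
    by (intro abs_summable_on_vec) (rule has_sum_imp_summable)
  then obtain M where M: "((\<lambda>\<alpha>. s ^ sum \<alpha> UNIV * norm (c \<alpha>)) has_sum M) UNIV"
    using \<open>s > 0\<close> by (auto simp: summable_on_def)
  have "M \<ge> 0" using M by (rule has_sum_nonneg) (use \<open>s > 0\<close> in auto)
  have main: "norm (f y - f z - L (y - z)) \<le> (2 * t / s * M) * norm (y - z)"
    if "0 < t" "t \<le> 1/2" "y \<in> ball a (min r (t * s))" "z \<in> ball a (min r (t * s))" for t y z
  proof -
    define g where "g \<alpha> = ((\<Prod>i\<in>UNIV. (y $ i - a $ i) ^ \<alpha> i) *\<^sub>R c \<alpha> -
        (\<Prod>i\<in>UNIV. (z $ i - a $ i) ^ \<alpha> i) *\<^sub>R c \<alpha>) -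
        (if sum \<alpha> UNIV = 1 then (\<Prod>i\<in>UNIV. ((y - z) $ i) ^ \<alpha> i) *\<^sub>R c \<alpha> else 0)" for \<alpha>
    have "((\<lambda>\<alpha>. g \<alpha>) has_sum (f y - f z - L (y - z))) UNIV"
      unfolding g_def using that by (intro has_sum_diff f linear_part) auto
    moreover have "((\<lambda>\<alpha>. (2 * t / s * norm (y - z)) * (s ^ sum \<alpha> UNIV * norm (c \<alpha>)))
        has_sum ((2 * t / s * norm (y - z)) * M)) UNIV"
      by (intro has_sum_cmult_right M)
    moreover have "norm (g \<alpha>) \<le> (2 * t / s * norm (y - z)) * (s ^ sum \<alpha> UNIV * norm (c \<alpha>))" for \<alpha>
    proof -
      consider "sum \<alpha> UNIV = 0" | "sum \<alpha> UNIV = 1" | "sum \<alpha> UNIV \<ge> 2" by linarith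
      then show ?thesis
      proof cases
        case 1
        then show ?thesis using that \<open>s > 0\<close> by (simp add: g_def)
      next
        case 2
        then obtain i where "\<alpha> = e i" using sum_eq_1_indicator unfolding e_def by blast
        then have "g \<alpha> = 0" by (simp only: g_def prod_e sum_e if_True) (simp add: algebra_simps)
        then show ?thesis using that \<open>s > 0\<close> by (simp add: sum_nonneg)
      next
        case 3
        define n where "n = sum \<alpha> UNIV"
        have comp: "\<bar>w $ i - a $ i\<bar> \<le> t * s" if "w \<in> ball a (min r (t * s))" for w i
          using component_le_norm_cart[of "w - a" i] that by (simp add: dist_norm norm_minus_commute)
        have "norm (g \<alpha>) = \<bar>(\<Prod>i\<in>UNIV. (y $ i - a $ i) ^ \<alpha> i) -
            (\<Prod>i\<in>UNIV. (z $ i - a $ i) ^ \<alpha> i)\<bar> * norm (c \<alpha>)"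
          using 3 by (simp add: g_def flip: scaleR_diff_left)
        also have "\<dots> \<le> ((t * s) ^ n * (real n * (norm (y - z) / (t * s)))) * norm (c \<alpha>)"
          unfolding n_def
        proof (intro mult_right_mono prod_power_diff_le_scaled)
          show "\<bar>y $ i - a $ i - (z $ i - a $ i)\<bar> \<le> norm (y - z)" for i
            using component_le_norm_cart[of "y - z" i] by simp
        qed (use that \<open>s > 0\<close> comp in auto)
        also have "\<dots> = (real n * t ^ n) * (norm (y - z) / (t * s) * (s ^ n * norm (c \<alpha>)))"
          by (simp add: power_mult_distrib)
        \<comment> \<open>Degree at least 2 gives a factor \<open>t ^ 2\<close>, uniformly in the
          degree; one \<open>t\<close> survives the division by \<open>t * s\<close>.\<close>
        also have "\<dots> \<le> (2 * t\<^sup>2) * (norm (y - z) / (t * s) * (s ^ n * norm (c \<alpha>)))"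
          using times_power_le_of_le_half[of t n] 3 that \<open>s > 0\<close>
          by (intro mult_right_mono) (auto simp: n_def)
        also have "\<dots> = (2 * t / s * norm (y - z)) * (s ^ n * norm (c \<alpha>))"
          using that \<open>s > 0\<close> by (simp add: power2_eq_square field_simps)
        finally show ?thesis by (simp add: n_def)
      qed
    qed
    ultimately have "norm (f y - f z - L (y - z)) \<le> (2 * t / s * norm (y - z)) * M"
      by (rule norm_infsum_le)
    then show ?thesis by (simp add: mult_ac)
  qed
  have "\<exists>d>0. \<forall>y\<in>ball a d. \<forall>z\<in>ball a d. norm (f y - f z - L (y - z)) \<le> \<epsilon> * norm (y - z)"
    if "\<epsilon> > 0" for \<epsilon>
  proof -
    \<comment> \<open>The bound 1/2 is what \<open>main\<close> requires, and the other makes its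
      constant \<open>2 * t / s * M\<close> at most \<open>\<epsilon>\<close>. Using
      \<open>M + 1\<close> avoids dividing by zero.\<close>
    define t where "t = min (1/2) (\<epsilon> * s / (2 * (M + 1)))"
    have t: "0 < t" "t \<le> 1/2" "t \<le> \<epsilon> * s / (2 * (M + 1))"
      unfolding t_def using that \<open>s > 0\<close> \<open>M \<ge> 0\<close> by (simp, linarith, linarith)
    have "2 * t / s * M \<le> 2 * t / s * (M + 1)"
      using t \<open>s > 0\<close> by (intro mult_left_mono) auto
    also have "\<dots> \<le> \<epsilon>" using t \<open>s > 0\<close> \<open>M \<ge> 0\<close> by (simp add: field_simps)
    finally have "2 * t / s * M \<le> \<epsilon>" .
    then have "norm (f y - f z - L (y - z)) \<le> \<epsilon> * norm (y - z)"
      if "y \<in> ball a (min r (t * s))" "z \<in> ball a (min r (t * s))" for y z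
      using main[OF t(1,2) that] mult_right_mono[of _ \<epsilon> "norm (y - z)"] by fastforce
    then show ?thesis
      using t \<open>s > 0\<close> \<open>r > 0\<close> by (intro exI[of _ "min r (t * s)"]) auto
  qed
  then show ?thesis using bl unfolding strictly_differentiable_at_def by blast
qed

section \<open>Openness of the regular locus\<close>

lemma Sing_iff_not_surj:
  assumes "(G has_derivative D) (at x)"
  shows "x \<in> Sing G \<longleftrightarrow> \<not> surj D"
proof -
  have "jacobian G (at x) = matrix D"
    using assms by (simp add: jacobian_def frechet_derivative_at[symmetric])
  moreover have "(*v) (matrix D) = D"
    using assms has_derivative_linear by (auto simp: fun_eq_iff)
  moreover have "rank (matrix D) \<le> CARD('b)"
    using rank_bound[of "matrix D"] by simp
  ultimately show ?thesis
    using full_rank_surjective[of "matrix D"] by (auto simp: Sing_def)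
qed

text \<open>Take a linear right inverse \<open>R\<close> of \<open>L\<close>. At nearby points the
  derivative \<open>D\<close> is so close to \<open>L\<close> that \<open>D \<circ> R\<close> is an
  injective endomorphism of the target, hence surjective, and then so is \<open>D\<close>.\<close>

lemma regular_points_near_strictly_differentiable:
  fixes G :: "real^'m \<Rightarrow> real^'p"
  assumes sd: "strictly_differentiable_at G L a" and "a \<notin> Sing G"
    and "open U" "a \<in> U" and diff: "\<And>x. x \<in> U \<Longrightarrow> G differentiable (at x)"
  shows "\<exists>d>0. ball a d \<inter> Sing G = {}"
proof -
  have bl: "bounded_linear L" using sd by (simp add: strictly_differentiable_at_def)
  have "surj L"
    using Sing_iff_not_surj[OF strictly_differentiable_at_imp_has_derivative[OF sd]] assms(2) by blast
  then obtain R where R: "linear R" "L \<circ> R = id"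
    using linear_surjective_right_inverse bounded_linear.linear[OF bl] by blast
  then obtain B where B: "B > 0" "\<And>k. norm (R k) \<le> B * norm k"
    using linear_bounded_pos by blast
  \<comment> \<open>With this tolerance \<open>D \<circ> R\<close> differs from
    \<open>L \<circ> R = id\<close> by at most half the norm.\<close>
  have "1 / (2 * B) > 0" using B by simp
  then obtain d where "d > 0" and d: "\<And>y z. \<lbrakk>y \<in> ball a d; z \<in> ball a d\<rbrakk> \<Longrightarrow>
      norm (G y - G z - L (y - z)) \<le> 1 / (2 * B) * norm (y - z)"
    using sd unfolding strictly_differentiable_at_def by meson
  obtain d' where "d' > 0" "ball a d' \<subseteq> U" using assms open_contains_ball by blast
  have "x \<notin> Sing G" if "x \<in> ball a (min d d')" for x
  proof -
    obtain D where D: "(G has_derivative D) (at x)"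
      using diff[of x] \<open>x \<in> ball a (min d d')\<close> \<open>ball a d' \<subseteq> U\<close> unfolding differentiable_def
      by (auto simp: subset_iff)
    have lin: "linear (D \<circ> R)"
      using R has_derivative_linear[OF D] by (intro linear_compose)
    have "k = 0" if "D (R k) = 0" for k
    proof -
      have "norm (D (R k) - L (R k)) \<le> 1 / (2 * B) * norm (R k)"
        by (rule strictly_differentiable_at_derivative_bound[OF d open_ball _ bl D])
          (use \<open>x \<in> ball a (min d d')\<close> in auto)
      also have "\<dots> \<le> 1 / (2 * B) * (B * norm k)"
        using B by (intro mult_left_mono) auto
      also have "\<dots> = norm k / 2" using B by simp
      finally have "norm k \<le> norm k / 2"
        using that R(2) by (simp add: o_def fun_eq_iff)
      then show ?thesis by simp
    qed
    then have "inj (D \<circ> R)"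
      using lin by (subst linear_injective_0) auto
    then have "surj (D \<circ> R)"
      using lin linear_injective_imp_surjective by blast
    then have "surj D" by (auto simp: surj_def)
    then show ?thesis using Sing_iff_not_surj[OF D] by blast
  qed
  then show ?thesis
    using \<open>d > 0\<close> \<open>d' > 0\<close> by (intro exI[of _ "min d d'"]) auto
qed

section \<open>Germs of images\<close>

text \<open>Closedness is required only inside the ball because \<open>Sing G\<close> is controlled
  only where \<open>G\<close> is analytic.\<close>

lemma same_germ_image_if_fibre_trivial:
  fixes f :: "'a::euclidean_space \<Rightarrow> 'b::real_normed_vector"
  assumes cont: "continuous_on (cball 0 r) f" and clo: "closed (K \<inter> cball 0 r)"
    and fibre: "\<And>x. \<lbrakk>x \<in> K; norm x \<le> r; f x = 0\<rbrakk> \<Longrightarrow> x = 0"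
    and \<epsilon>: "0 < \<epsilon>" "\<epsilon> < r" "0 < \<epsilon>'" "\<epsilon>' < r"
  shows "same_germ (f ` (ball 0 \<epsilon> \<inter> K)) (f ` (ball 0 \<epsilon>' \<inter> K))"
proof -
  define \<delta> where "\<delta> = min \<epsilon> \<epsilon>'"
  \<comment> \<open>Points of \<open>K\<close> on which the two balls can disagree within
    \<open>cball 0 r\<close> all lie in \<open>C\<close>. The compact image of \<open>C\<close>
    misses 0, so it misses a whole ball of radius \<open>s\<close>.\<close>
  define C where "C = (K \<inter> cball 0 r) - ball 0 \<delta>"
  have "C = cball 0 r \<inter> ((K \<inter> cball 0 r) - ball 0 \<delta>)" by (auto simp: C_def)
  then have "compact C"
    by (metis clo closed_Diff open_ball compact_Int_closed compact_cball)
  then have "compact (f ` C)"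
    using cont by (intro compact_continuous_image) (auto simp: C_def elim: continuous_on_subset)
  moreover have "0 \<notin> f ` C"
    using fibre \<epsilon> by (force simp: C_def \<delta>_def)
  ultimately obtain s where "s > 0" and s: "ball 0 s \<subseteq> - f ` C"
    by (meson ComplI compact_imp_closed open_Compl open_contains_ball)
  have small: "x \<in> ball 0 \<epsilon> \<inter> ball 0 \<epsilon>'" if "x \<in> K" "norm x < r" "norm (f x) < s" for x
  proof -
    have "f x \<in> ball 0 s" using that by simp
    then have "x \<notin> C" using s by blast
    then show ?thesis using that by (auto simp: C_def \<delta>_def)
  qed
  show ?thesis
    unfolding same_germ_def
  proof (intro exI conjI)
    show "f ` (ball 0 \<epsilon> \<inter> K) \<inter> ball 0 s = f ` (ball 0 \<epsilon>' \<inter> K) \<inter> ball 0 s"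
      using small \<epsilon> by (auto intro!: imageI)
  qed fact
qed

theorem proposition2p4:
  fixes G :: "real^'m \<Rightarrow> real^'p"
  assumes "CARD('m) \<ge> CARD('p)"
    and "real_analytic_map_germ G"
    and "same_germ (Sing G \<inter> G -` {0}) {0}"
  shows "nice_map_germ G"
proof -
  obtain U where U: "open U" "0 \<in> U" "\<And>a. a \<in> U \<Longrightarrow> real_analytic_at G a" and "G 0 = 0"
    using assms(2) unfolding real_analytic_map_germ_def by blast
  have sd: "\<exists>L. strictly_differentiable_at G L x" if "x \<in> U" for x
    using U(3)[OF that] by (rule real_analytic_at_imp_strictly_differentiable_at)
  have diff: "G differentiable (at x)" if "x \<in> U" for x
    using sd[OF that] strictly_differentiable_at_imp_has_derivative
    unfolding differentiable_def by blast
  obtain r1 where r1: "r1 > 0" "cball 0 r1 \<subseteq> U"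
    using U open_contains_cball by blast
  obtain r2 where r2: "r2 > 0" "Sing G \<inter> G -` {0} \<inter> ball 0 r2 = {0} \<inter> ball 0 r2"
    using assms(3) unfolding same_germ_def by blast
  \<comment> \<open>Halving \<open>r2\<close> puts the closed ball of radius \<open>r\<close> inside
    the open ball on which the hypothesis on the singular fibre holds.\<close>
  define r where "r = min r1 (r2 / 2)"
  have "r > 0" and rU: "cball 0 r \<subseteq> U" using r1 r2 by (auto simp: r_def)
  have sing0: "x = 0" if "x \<in> Sing G" "norm x \<le> r" "G x = 0" for x
  proof -
    have "norm x < r2" using that(2) r2(1) by (simp add: r_def)
    then have "x \<in> Sing G \<inter> G -` {0} \<inter> ball 0 r2" using that by simp
    then show ?thesis unfolding r2(2) by simp
  qed
  have contU: "continuous_on U G"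
    using diff by (simp add: continuous_at_imp_continuous_on differentiable_imp_continuous_within)
  then have cont: "continuous_on (cball 0 r) G"
    using rU continuous_on_subset by blast
  \<comment> \<open>The complement is open: a regular point in the ball has a neighbourhood of
    regular points, and a point outside the closed ball has a neighbourhood outside it.\<close>
  have "closed (Sing G \<inter> cball 0 r)"
    unfolding closed_def
  proof (subst open_contains_ball, intro ballI)
    fix x assume x: "x \<in> - (Sing G \<inter> cball 0 r)"
    show "\<exists>d>0. ball x d \<subseteq> - (Sing G \<inter> cball 0 r)"
    proof (cases "x \<in> cball 0 r")
      case True
      then obtain L where "strictly_differentiable_at G L x" using rU sd by blast
      then show ?thesis
        using regular_points_near_strictly_differentiable[of G L x U] \<open>open U\<close> diff x True rU by blast
    next
      case False
      then have "x \<in> - cball 0 r" by simp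
      moreover have "open (- cball 0 r :: (real^'m) set)" by (simp add: open_Compl)
      ultimately show ?thesis by (meson Compl_anti_mono Int_lower2 open_contains_ball subset_trans)
    qed
  qed
  then have sing: "well_defined_image_germ G (Sing G)"
    unfolding well_defined_image_germ_def
    using \<open>r > 0\<close> same_germ_image_if_fibre_trivial[OF cont _ sing0] by blast
  have "well_defined_image_germ G UNIV"
  proof (cases "\<exists>\<rho>>0. \<rho> \<le> r \<and> (\<forall>x. norm x \<le> \<rho> \<and> G x = 0 \<longrightarrow> x = 0)")
    case True
    then obtain \<rho> where \<rho>: "\<rho> > 0" "\<rho> \<le> r" "\<And>x. norm x \<le> \<rho> \<Longrightarrow> G x = 0 \<Longrightarrow> x = 0" by blast
    have "continuous_on (cball 0 \<rho>) G"
      by (rule continuous_on_subset[OF cont]) (use \<rho> in auto)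
    then show ?thesis
      unfolding well_defined_image_germ_def
      using \<rho> same_germ_image_if_fibre_trivial[of \<rho> G UNIV] by auto
  next
    case False
    have nbhd: "0 \<in> interior (G ` ball 0 \<epsilon>)" if "\<epsilon> > 0" for \<epsilon>
    proof -
      \<comment> \<open>Taking this radius for \<open>\<rho>\<close> in the negated case assumption
        gives a nonzero zero of \<open>G\<close> lying in the open ball of radius
        \<open>\<epsilon>\<close> and in the range of \<open>sing0\<close>; hence it is
        regular.\<close>
      have "min r (\<epsilon> / 2) > 0" using that \<open>r > 0\<close> by simp
      then obtain x where x: "norm x \<le> min r (\<epsilon> / 2)" "G x = 0" "x \<noteq> 0"
        using False by (meson min.cobounded1)
      have "x \<in> U" using x rU by auto
      then obtain L where L: "strictly_differentiable_at G L x" using sd by blast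
      note der = strictly_differentiable_at_imp_has_derivative[OF L]
      have "surj L" using Sing_iff_not_surj[OF der] sing0 x by auto
      then obtain R where R: "linear R" "L \<circ> R = id"
        using linear_surjective_right_inverse has_derivative_linear[OF der] by blast
      \<comment> \<open>This open mapping theorem asks only for continuity on \<open>U\<close> and a
        derivative with a right inverse at the single point \<open>x\<close>. Since
        \<open>G x = 0\<close>, the image is a neighbourhood of 0.\<close>
      have "G x \<in> interior (G ` (ball 0 \<epsilon> \<inter> U))"
      proof (rule sussmann_open_mapping[OF \<open>open U\<close> contU \<open>x \<in> U\<close> der])
        show "bounded_linear R" using R linear_conv_bounded_linear by blast
        show "x \<in> interior (ball 0 \<epsilon> \<inter> U)"
          using x that \<open>x \<in> U\<close> U(1) by (simp add: interior_open open_Int)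
      qed (use R in auto)
      then show ?thesis
        using x(2) interior_mono[of "G ` (ball 0 \<epsilon> \<inter> U)" "G ` ball 0 \<epsilon>"] by auto
    qed
    \<comment> \<open>Both images contain a common ball around 0, so each has the germ of the whole
      space. The radii are arbitrary, hence the threshold 1 chosen below.\<close>
    have "same_germ (G ` (ball 0 \<epsilon> \<inter> UNIV)) (G ` (ball 0 \<epsilon>' \<inter> UNIV))"
      if "\<epsilon> > 0" "\<epsilon>' > 0" for \<epsilon> \<epsilon>'
    proof -
      have "0 \<in> interior (G ` ball 0 \<epsilon> \<inter> G ` ball 0 \<epsilon>')"
        using nbhd that by simp
      then obtain d where "d > 0" "ball 0 d \<subseteq> G ` ball 0 \<epsilon> \<inter> G ` ball 0 \<epsilon>'"
        unfolding mem_interior by blast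
      then show ?thesis unfolding same_germ_def by (intro exI[of _ d]) auto
    qed
    then show ?thesis
      unfolding well_defined_image_germ_def by (intro exI[of _ 1]) auto
  qed
  with sing show ?thesis unfolding nice_map_germ_def by blast
qed

end
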